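(* For every integer $d\ge 2$, $$\operatorname{aff}_{\mathbb{Z}}\big(\mathcal{F}(\mathcal{P}^d)\big)=\mathrm{E}_d\cap\mathbb{Z}^d,$$ where $\mathcal{F}(\mathcal{P}^d)\subset\mathbb{Z}^d$ is the set of $f$-vectors of all $d$-dimensional convex polytopes and $\mathrm{E}_d=\{(f_0,\dots,f_{d-1})\in\mathbb{R}^d: f_0-f_1+\dots+(-1)^{d-1}f_{d-1}=1-(-1)^d\}$ is the Euler hyperplane.
   Context: A $d$-polytope is a $d$-dimensional convex polytope. Its $f$-vector is $f(P)=(f_0(P),\dots,f_{d-1}(P))\in\mathbb{Z}^d$, where $f_i(P)$ is the number of $i$-dimensional faces of $P$. For a set $S\subseteq\mathbb{Z}^d$, $\operatorname{aff}_{\mathbb{Z}}S$ is the set of all integral affine combinations $a_1v_1+\dots+a_nv_n$ with $n\ge1$, $v_1,\dots,v_n\in S$, $a_1,\dots,a_n\in\mathbb{Z}$ and $a_1+\dots+a_n=1$. *)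

theory Defs
  imports "HOL-Analysis.Analysis"
begin

text \<open>
  Since \<open>d\<close> is a number rather than a type, a point of \<open>\<real>\<^sup>d\<close> is a function
  on \<open>nat\<close> that vanishes from \<open>d\<close> on.  Coordinates are numbered \<open>0, \<dots>, d - 1\<close>,
  as in \<open>(f\<^sub>0, \<dots>, f\<^sub>d\<^sub>-\<^sub>1)\<close>.
\<close>

definition real_space :: "nat \<Rightarrow> (nat \<Rightarrow> real) set" where
  "real_space d = {x. \<forall>i\<ge>d. x i = 0}"

definition int_lattice :: "nat \<Rightarrow> (nat \<Rightarrow> real) set" where
  "int_lattice d = {x \<in> real_space d. \<forall>i<d. x i \<in> \<int>}"

definition int_affine_hull :: "(nat \<Rightarrow> real) set \<Rightarrow> (nat \<Rightarrow> real) set" where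
  "int_affine_hull S =
     {x. \<exists>(n::nat) (v :: nat \<Rightarrow> nat \<Rightarrow> real) (a :: nat \<Rightarrow> int).
           n \<ge> 1 \<and> (\<forall>k\<in>{1..n}. v k \<in> S) \<and> (\<Sum>k=1..n. a k) = 1 \<and>
           x = (\<lambda>i. \<Sum>k=1..n. of_int (a k) * v k i)}"

definition euler_hyperplane :: "nat \<Rightarrow> (nat \<Rightarrow> real) set" where
  "euler_hyperplane d =
     {x \<in> real_space d. (\<Sum>i<d. (-1) ^ i * x i) = 1 - (-1) ^ d}"

definition f_vector :: "nat \<Rightarrow> 'a::euclidean_space set \<Rightarrow> nat \<Rightarrow> real" where
  "f_vector d P =
     (\<lambda>i. if i < d then real (card {F. F face_of P \<and> aff_dim F = int i}) else 0)"

text \<open>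
  A \<open>d\<close>-polytope may lie in an ambient space of dimension larger than \<open>d\<close>.  The
  ambient space is the type argument; up to affine isomorphism, every
  \<open>d\<close>-polytope occurs in it as soon as its dimension is at least \<open>d\<close>.
\<close>

definition f_vectors :: "'a::euclidean_space itself \<Rightarrow> nat \<Rightarrow> (nat \<Rightarrow> real) set" where
  "f_vectors _ d = {f_vector d P | P :: 'a set. polytope P \<and> aff_dim P = int d}"

end

theory Submission
  imports Defs
begin

text \<open>
  The Euler relation is proved by sweeping a hyperplane.  Nonempty faces of a slice
  \<open>P \<inter> {x. a \<bullet> x = t}\<close> correspond to the faces of \<open>P\<close> whose relative interior meets the
  hyperplane.  Let \<open>T\<close> be the set of extreme values of \<open>a\<close> on the faces of \<open>P\<close>.  By induction on
  the dimension, every slice has Euler characteristic 1; summing this over the \<open>t \<in> T\<close> and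
  subtracting the sum over one point in each of the \<open>card T - 1\<close> gaps of \<open>T\<close>, every face
  contributes exactly its sign.

  Conversely, taking pyramids acts on f-vectors by an injective affine map which sends the lattice
  points of the Euler hyperplane for \<open>d\<close> onto those for \<open>d + 1\<close> on which a certain integral
  functional takes a fixed value.  A pyramid over a pyramid, truncated at its apex, has the value
  of this functional off by one, so its f-vector together with those of the pyramids generates
  everything, by induction on \<open>d\<close>.
\<close>

section \<open>Faces of slices and truncations\<close>

text \<open>\<open>face_of\<close> also admits the empty set, of affine dimension -1. The Euler
  relation runs over the nonempty faces, with \<open>P\<close> itself among them.\<close>

definition nfaces :: "'a::euclidean_space set \<Rightarrow> 'a set set" where
  "nfaces P = {F. F face_of P \<and> F \<noteq> {}}"

lemma finite_nfaces: "polyhedron P \<Longrightarrow> finite (nfaces P)"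
  unfolding nfaces_def by (rule finite_subset[OF _ finite_polyhedron_faces]) auto

text \<open>Induction on the dimension: a point outside the relative interior lies on a facet, which
  has smaller dimension, and a face of a facet is a face.\<close>

lemma polyhedron_point_in_rel_interior_face:
  fixes P :: "'a::euclidean_space set"
  assumes "polyhedron P" "x \<in> P"
  obtains F where "F face_of P" "x \<in> rel_interior F"
proof -
  have "\<exists>F. F face_of P \<and> x \<in> rel_interior F"
    using assms
  proof (induction "nat (aff_dim P + 1)" arbitrary: P rule: less_induct)
    case less
    show ?case
    proof (cases "x \<in> rel_interior P")
      case True
      then show ?thesis using less.prems face_of_refl polyhedron_imp_convex by blast
    next
      case False
      then obtain G where G: "G facet_of P" "x \<in> G"
        using less.prems rel_boundary_of_polyhedron[of P] by blast
      then have "nat (aff_dim G + 1) < nat (aff_dim P + 1)"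
        using aff_dim_geq[of G] unfolding facet_of_def by auto
      then obtain F where "F face_of G" "x \<in> rel_interior F"
        using less.hyps G less.prems face_of_polyhedron_polyhedron facet_of_imp_face_of by metis
      then show ?thesis using G facet_of_imp_face_of face_of_trans by blast
    qed
  qed
  then show thesis using that by blast
qed

lemma aff_dim_nonneg_iff: "0 \<le> aff_dim (S::'a::euclidean_space set) \<longleftrightarrow> S \<noteq> {}"
  using aff_dim_geq[of S] aff_dim_empty[of S] by linarith

lemma nfaces_convex: "F \<in> nfaces P \<Longrightarrow> convex F"
  unfolding nfaces_def using face_of_imp_convex by blast

text \<open>A relative interior point \<open>x\<close> of a face \<open>G\<close> of
  \<open>A \<inter> B\<close> selects faces \<open>F\<close> and \<open>K\<close> with
  \<open>x\<close> in both relative interiors; \<open>G\<close> and \<open>F \<inter> K\<close> are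
  then faces whose relative interiors share \<open>x\<close>, hence equal. Injectivity: a face of
  \<open>A\<close> containing a relative interior point of \<open>F\<close> contains all of
  \<open>F\<close>, and likewise for \<open>B\<close>.\<close>

lemma bij_betw_nfaces_Int:
  fixes A B :: "'a::euclidean_space set"
  assumes "polyhedron A" "polyhedron B"
  shows "bij_betw (\<lambda>(F, K). F \<inter> K)
    {(F, K). F \<in> nfaces A \<and> K \<in> nfaces B \<and> rel_interior F \<inter> rel_interior K \<noteq> {}}
    (nfaces (A \<inter> B))" (is "bij_betw ?f ?S _")
proof (rule bij_betw_imageI)
  have sub: "F \<subseteq> F' \<and> K \<subseteq> K'"
    if "(F, K) \<in> ?S" "(F', K') \<in> ?S" "F \<inter> K = F' \<inter> K'" for F K F' K'
  proof -
    have "rel_interior F \<inter> rel_interior K \<noteq> {}" using that(1) by simp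
    then obtain x where x: "x \<in> rel_interior F" "x \<in> rel_interior K" by blast
    then have "x \<in> F'" "x \<in> K'"
      using that(3) rel_interior_subset by blast+
    then show ?thesis
      using that x unfolding nfaces_def
      by (auto intro!: subset_of_face_of[of F' A F, THEN subsetD] subset_of_face_of[of K' B K, THEN subsetD]
          dest: face_of_imp_subset)
  qed
  show "inj_on ?f ?S"
    using sub by (intro inj_onI) (auto, blast+)
  show "?f ` ?S = nfaces (A \<inter> B)"
  proof (intro equalityI subsetI)
    fix G assume "G \<in> ?f ` ?S"
    then obtain F K where FK: "(F, K) \<in> ?S" "G = F \<inter> K" by auto
    then have "F \<inter> K \<noteq> {}" using rel_interior_subset by blast
    then show "G \<in> nfaces (A \<inter> B)"
      using FK by (auto simp: nfaces_def intro: face_of_Int_Int)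
  next
    fix G assume "G \<in> nfaces (A \<inter> B)"
    then have G: "G face_of (A \<inter> B)" "G \<noteq> {}" by (auto simp: nfaces_def)
    then obtain x where x: "x \<in> rel_interior G"
      using rel_interior_eq_empty face_of_imp_convex by blast
    then have "x \<in> A" "x \<in> B"
      using G(1) face_of_imp_subset rel_interior_subset by blast+
    then obtain F K where F: "F face_of A" "x \<in> rel_interior F" and K: "K face_of B" "x \<in> rel_interior K"
      using polyhedron_point_in_rel_interior_face assms by metis
    have "rel_interior (F \<inter> K) = rel_interior F \<inter> rel_interior K"
      using F K face_of_imp_convex by (intro convex_rel_interior_inter_two) blast+
    then have "G = F \<inter> K"
      using face_of_eq[OF G(1) face_of_Int_Int[OF F(1) K(1)]] x F K by blast
    moreover have "(F, K) \<in> ?S" using F K unfolding nfaces_def by auto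
    ultimately show "G \<in> ?f ` ?S" by force
  qed
qed

lemma nfaces_affine: "affine S \<Longrightarrow> S \<noteq> {} \<Longrightarrow> nfaces S = {S}"
  using face_of_affine_trivial[of S] by (auto simp: nfaces_def face_of_refl affine_imp_convex)

lemma inner_eq_solvable:
  fixes a :: "'a::euclidean_space"
  assumes "a \<noteq> 0"
  obtains x where "a \<bullet> x = b"
  using that[of "(b / (a \<bullet> a)) *\<^sub>R a"] assms by simp

lemma nfaces_halfspace_ge:
  fixes a :: "'a::euclidean_space"
  assumes "a \<noteq> 0"
  shows "nfaces {x. a \<bullet> x \<ge> b} = {{x. a \<bullet> x = b}, {x. a \<bullet> x \<ge> b}}"
proof -
  obtain c where c: "a \<bullet> c = b" using inner_eq_solvable[OF assms] .
  then have "{x. a \<bullet> x = b} \<noteq> {}" "{x. a \<bullet> x \<ge> b} \<noteq> {}" by auto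
  then show ?thesis by (auto simp: nfaces_def face_of_halfspace_ge)
qed

section \<open>Dimensions of sections, and sums over the faces of a section\<close>

lemma aff_dim_Int_open:
  assumes "convex S" "open U" "rel_interior S \<inter> U \<noteq> {}" "S \<inter> U \<subseteq> T"
  shows "aff_dim (S \<inter> T) = aff_dim (S::'a::euclidean_space set)"
proof -
  have "S \<inter> U \<noteq> {}" using assms(3) rel_interior_subset by blast
  then have "affine hull (S \<inter> U) = affine hull S"
    using assms by (intro affine_hull_convex_Int_open)
  then have "aff_dim S = aff_dim (S \<inter> U)" by (metis aff_dim_affine_hull)
  also have "\<dots> \<le> aff_dim (S \<inter> T)" using assms(4) by (intro aff_dim_subset) auto
  finally show ?thesis using aff_dim_subset[of "S \<inter> T" S] by auto
qed

text \<open>Around a relative interior point on the hyperplane, \<open>S\<close> agrees with its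
  affine hull, so the section of \<open>S\<close> has the dimension of the section of
  \<open>affine hull S\<close>.\<close>

lemma aff_dim_Int_hyperplane:
  fixes S :: "'a::euclidean_space set"
  assumes "convex S" "rel_interior S \<inter> {x. a \<bullet> x = b} \<noteq> {}"
  shows "aff_dim (S \<inter> {x. a \<bullet> x = b}) =
    (if S \<subseteq> {x. a \<bullet> x = b} then aff_dim S else aff_dim S - 1)"
proof -
  let ?H = "{x. a \<bullet> x = b}"
  have aH: "affine ?H" by (rule affine_hyperplane)
  obtain U where U: "open U" "rel_interior S = affine hull S \<inter> U"
    using openin_rel_interior[of S] by (auto simp: openin_open)
  have "affine hull (affine hull S \<inter> ?H \<inter> U) = affine hull (affine hull S \<inter> ?H)"
    using assms(2) U by (intro affine_hull_convex_Int_open affine_imp_convex affine_Int affine_affine_hull aH) auto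
  then have "aff_dim (affine hull S \<inter> ?H) = aff_dim (affine hull S \<inter> ?H \<inter> U)"
    by (metis aff_dim_affine_hull)
  also have "affine hull S \<inter> ?H \<inter> U \<subseteq> S \<inter> ?H"
    using U rel_interior_subset by blast
  then have "aff_dim (affine hull S \<inter> ?H \<inter> U) \<le> aff_dim (S \<inter> ?H)" by (rule aff_dim_subset)
  finally have "aff_dim (S \<inter> ?H) = aff_dim (affine hull S \<inter> ?H)"
    using aff_dim_subset[OF Int_mono[OF hull_subset[of S affine] order_refl[of ?H]]] by (simp add: antisym)
  moreover have "affine hull S \<inter> ?H \<noteq> {}" using assms(2) U by auto
  moreover have "affine hull S \<subseteq> ?H \<longleftrightarrow> S \<subseteq> ?H"
    using aH hull_subset[of S affine] hull_minimal[of S ?H affine] by blast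
  ultimately show ?thesis by (simp add: aff_dim_affine_Int_hyperplane)
qed

text \<open>The only nonempty face of a hyperplane is the hyperplane, so the bijection matches the
  faces of the slice with the faces of \<open>P\<close> whose relative interior it meets.\<close>

lemma sum_nfaces_hyperplane:
  fixes P :: "'a::euclidean_space set" and h :: "int \<Rightarrow> real"
  assumes "polyhedron P" "P \<inter> {x. a \<bullet> x = b} \<noteq> {}"
  shows "(\<Sum>G\<in>nfaces (P \<inter> {x. a \<bullet> x = b}). h (aff_dim G)) =
    (\<Sum>F\<in>{F\<in>nfaces P. rel_interior F \<inter> {x. a \<bullet> x = b} \<noteq> {}}.
       h (if F \<subseteq> {x. a \<bullet> x = b} then aff_dim F else aff_dim F - 1))"
proof -
  let ?H = "{x. a \<bullet> x = b}" and ?N = "{F\<in>nfaces P. rel_interior F \<inter> {x. a \<bullet> x = b} \<noteq> {}}"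
  have aH: "affine ?H" by (rule affine_hyperplane)
  have rH: "rel_interior ?H = ?H" and nH: "nfaces ?H = {?H}"
    using assms(2) by (simp add: rel_interior_affine aH, intro nfaces_affine aH) auto
  have "{(F, K). F \<in> nfaces P \<and> K \<in> nfaces ?H \<and> rel_interior F \<inter> rel_interior K \<noteq> {}} = ?N \<times> {?H}"
    unfolding nH using rH by auto
  then have "bij_betw (\<lambda>(F, K). F \<inter> K) (?N \<times> {?H}) (nfaces (P \<inter> ?H))"
    using bij_betw_nfaces_Int[OF assms(1) polyhedron_hyperplane[of a b]] by simp
  from sum.reindex_bij_betw[OF this, of "\<lambda>G. h (aff_dim G)"]
  have "(\<Sum>G\<in>nfaces (P \<inter> ?H). h (aff_dim G)) = (\<Sum>(F, K)\<in>?N \<times> {?H}. h (aff_dim (F \<inter> K)))"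
    by (simp add: case_prod_unfold)
  also have "\<dots> = (\<Sum>F\<in>?N. h (aff_dim (F \<inter> ?H)))"
    by (subst sum.cartesian_product[symmetric]) simp
  also have "\<dots> = (\<Sum>F\<in>?N. h (if F \<subseteq> ?H then aff_dim F else aff_dim F - 1))"
    by (intro sum.cong refl arg_cong[of _ _ h] aff_dim_Int_hyperplane) (auto intro: nfaces_convex)
  finally show ?thesis .
qed

text \<open>A half-space has two nonempty faces, itself and its boundary. A face of \<open>P\<close>
  that crosses the boundary is therefore counted twice: for the part that is kept, of unchanged
  dimension, and for its section.\<close>

lemma sum_nfaces_halfspace:
  fixes P :: "'a::euclidean_space set" and h :: "int \<Rightarrow> real"
  assumes "polyhedron P" "a \<noteq> 0"
  shows "(\<Sum>G\<in>nfaces (P \<inter> {x. a \<bullet> x \<ge> b}). h (aff_dim G)) =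
    (\<Sum>F\<in>{F\<in>nfaces P. rel_interior F \<inter> {x. a \<bullet> x > b} \<noteq> {}}. h (aff_dim F)) +
    (\<Sum>F\<in>{F\<in>nfaces P. rel_interior F \<inter> {x. a \<bullet> x = b} \<noteq> {}}.
       h (if F \<subseteq> {x. a \<bullet> x = b} then aff_dim F else aff_dim F - 1))"
proof -
  let ?H = "{x. a \<bullet> x = b}" and ?G = "{x. a \<bullet> x \<ge> b}" and ?O = "{x. a \<bullet> x > b}"
  let ?N = "{F\<in>nfaces P. rel_interior F \<inter> ?H \<noteq> {}}" and ?M = "{F\<in>nfaces P. rel_interior F \<inter> ?O \<noteq> {}}"
  have rG: "rel_interior ?G = ?O"
  proof -
    obtain x where "a \<bullet> x = b + 1" using inner_eq_solvable[OF assms(2)] .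
    then have "?O \<noteq> {}" by (auto intro: exI[of _ x])
    then show ?thesis
      using interior_halfspace_ge[OF assms(2), of b] rel_interior_nonempty_interior[of ?G] by simp
  qed
  have rH: "rel_interior ?H = ?H" by (simp add: rel_interior_affine affine_hyperplane)
  have ne: "?H \<noteq> ?G"
  proof -
    obtain x where "a \<bullet> x = b + 1" using inner_eq_solvable[OF assms(2)] .
    then have "x \<in> ?G" "x \<notin> ?H" by auto
    then show ?thesis by blast
  qed
  have "{(F, K). F \<in> nfaces P \<and> K \<in> nfaces ?G \<and> rel_interior F \<inter> rel_interior K \<noteq> {}}
     = ?N \<times> {?H} \<union> ?M \<times> {?G}"
    using rG rH by (auto simp: nfaces_halfspace_ge[OF assms(2)])
  then have "bij_betw (\<lambda>(F, K). F \<inter> K) (?N \<times> {?H} \<union> ?M \<times> {?G}) (nfaces (P \<inter> ?G))"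
    using bij_betw_nfaces_Int[OF assms(1) polyhedron_halfspace_ge[of b a]] by simp
  from sum.reindex_bij_betw[OF this, of "\<lambda>G. h (aff_dim G)"]
  have "(\<Sum>G\<in>nfaces (P \<inter> ?G). h (aff_dim G)) =
     (\<Sum>(F,K)\<in>?N \<times> {?H} \<union> ?M \<times> {?G}. h (aff_dim (F \<inter> K)))"
    by (simp add: case_prod_unfold)
  also have "\<dots> = (\<Sum>(F,K)\<in>?N \<times> {?H}. h (aff_dim (F \<inter> K))) + (\<Sum>(F,K)\<in>?M \<times> {?G}. h (aff_dim (F \<inter> K)))"
    using finite_nfaces[OF assms(1)] ne by (intro sum.union_disjoint) auto
  also have "(\<Sum>(F,K)\<in>?N \<times> {?H}. h (aff_dim (F \<inter> K))) = (\<Sum>F\<in>?N. h (if F \<subseteq> ?H then aff_dim F else aff_dim F - 1))"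
    by (subst sum.cartesian_product[symmetric], simp,
        intro sum.cong refl arg_cong[of _ _ h] aff_dim_Int_hyperplane)
      (auto intro: nfaces_convex)
  also have "(\<Sum>(F,K)\<in>?M \<times> {?G}. h (aff_dim (F \<inter> K))) = (\<Sum>F\<in>?M. h (aff_dim F))"
    by (subst sum.cartesian_product[symmetric]) (auto intro!: sum.cong arg_cong[of _ _ h] aff_dim_Int_open[of _ ?O] simp: nfaces_convex open_halfspace_gt)
  finally show ?thesis by simp
qed

section \<open>The Euler relation\<close>

definition face_sign :: "'a::euclidean_space set \<Rightarrow> real" where
  "face_sign F = (-1) ^ nat (aff_dim F)"

lemma nfaces_polytope_compact: "polytope P \<Longrightarrow> F \<in> nfaces P \<Longrightarrow> compact F \<and> convex F \<and> F \<noteq> {}"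
  using face_of_polytope_polytope polytope_imp_compact polytope_imp_convex by (auto simp: nfaces_def)

section \<open>Heights of faces under a linear functional\<close>

lemma inner_image_interval:
  fixes F :: "'a::euclidean_space set"
  assumes "compact F" "convex F" "F \<noteq> {}"
  shows "\<exists>m M. m \<le> M \<and> (\<bullet>) a ` F = {m..M}"
proof -
  have cont: "continuous_on F ((\<bullet>) a)" by (intro continuous_intros)
  have "compact ((\<bullet>) a ` F)" "connected ((\<bullet>) a ` F)"
    using compact_continuous_image[OF cont] connected_continuous_image[OF cont] assms convex_connected
    by auto
  then obtain m M where "(\<bullet>) a ` F = {m..M}"
    using connected_compact_interval_1[of "(\<bullet>) a ` F"] by auto
  with assms(3) show ?thesis by (metis atLeastatMost_empty_iff image_is_empty)
qed

text \<open>Relative interiors commute with linear images, so \<open>a\<close> maps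
  \<open>rel_interior F\<close> onto \<open>rel_interior {m..M}\<close>: a single point or an open
  interval.\<close>

lemma rel_interior_meets_hyperplane_iff:
  fixes F :: "'a::euclidean_space set"
  assumes "convex F" "(\<bullet>) a ` F = {m..M}"
  shows "rel_interior F \<inter> {x. a \<bullet> x = t} \<noteq> {} \<longleftrightarrow> (if m = M then t = m else m < t \<and> t < M)"
proof -
  have "rel_interior F \<inter> {x. a \<bullet> x = t} \<noteq> {} \<longleftrightarrow> t \<in> (\<bullet>) a ` rel_interior F"
    by auto
  also have "(\<bullet>) a ` rel_interior F = rel_interior {m..M}"
    using rel_interior_convex_linear_image[of "(\<bullet>) a" F] assms
    by (simp add: bounded_linear.linear bounded_linear_inner_right)
  also have "rel_interior {m..M} = (if m = M then {m} else {m<..<M})"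
    using rel_interior_real_box[of m M] by (cases m M rule: linorder_cases) auto
  finally show ?thesis by auto
qed

text \<open>The function \<open>u\<close> picks a point in each gap between consecutive elements of \<open>T\<close>.\<close>

lemma card_gaps_between:
  fixes T :: "real set"
  assumes "finite T" "T \<noteq> {}"
  obtains u where "\<And>t. t \<in> T - {Max T} \<Longrightarrow> t < u t \<and> u t < Max T \<and> u t \<notin> T"
    and "\<And>m M. m \<in> T \<Longrightarrow> M \<in> T \<Longrightarrow> m < M \<Longrightarrow>
       card {t \<in> T - {Max T}. m < u t \<and> u t < M} = card {t \<in> T. m < t \<and> t < M} + 1"
proof -
  define s where "s t = Min {x\<in>T. t < x}" for t
  define u where "u t = (t + s t) / 2" for t
  have s: "t < s t \<and> s t \<in> T \<and> (\<forall>x\<in>T. t < x \<longrightarrow> s t \<le> x)" if "t \<in> T - {Max T}" for t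
  proof -
    have "t < Max T" using that assms(1) by (metis DiffE Max_ge insertI1 order_less_le singletonD)
    then have "{x\<in>T. t < x} \<noteq> {}" using Max_in[OF assms] by blast
    then have "Min {x\<in>T. t < x} \<in> {x\<in>T. t < x}" using assms by (intro Min_in) auto
    then show ?thesis using assms unfolding s_def by auto
  qed
  have u: "t < u t \<and> u t < s t" if "t \<in> T - {Max T}" for t
    using s[OF that] by (auto simp: u_def field_simps)
  show thesis
  proof (rule that[of u])
    fix t assume t: "t \<in> T - {Max T}"
    have "u t \<notin> T"
      using s[OF t] u[OF t] by fastforce
    moreover have "s t \<le> Max T" using s[OF t] assms by auto
    ultimately show "t < u t \<and> u t < Max T \<and> u t \<notin> T" using u[OF t] by auto
  next
    fix m M assume m: "m \<in> T" "M \<in> T" "m < M"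
    \<comment> \<open>As \<open>m\<close> and \<open>M\<close> belong to \<open>T\<close>, neither
      can lie strictly between \<open>t\<close> and its successor \<open>s t\<close>. The gap points
      inside the interval are thus indexed by their left ends, and the left end \<open>m\<close>
      accounts for the extra 1.\<close>
    have *: "m < u t \<and> u t < M \<longleftrightarrow> m \<le> t \<and> t < M" if t: "t \<in> T - {Max T}" for t
      using s[OF t] u[OF t] m by (smt (verit, best))
    have "M \<le> Max T" using m assms by auto
    then have "{t \<in> T - {Max T}. m \<le> t \<and> t < M} = insert m {t \<in> T. m < t \<and> t < M}"
      using m by auto
    moreover have "{t \<in> T - {Max T}. m < u t \<and> u t < M} = {t \<in> T - {Max T}. m \<le> t \<and> t < M}"
      using * by blast
    ultimately have "{t \<in> T - {Max T}. m < u t \<and> u t < M} = insert m {t \<in> T. m < t \<and> t < M}"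
      by simp
    then show "card {t \<in> T - {Max T}. m < u t \<and> u t < M} = card {t \<in> T. m < t \<and> t < M} + 1"
      using assms by simp
  qed
qed

text \<open>The sign of the face that \<open>F\<close> induces on the slice at height
  \<open>t\<close>. The value 0 when there is none lets every slice be summed over the same index
  set \<open>nfaces P\<close>, so that sums over heights and over faces can be exchanged.\<close>

definition slice_term :: "'a::euclidean_space \<Rightarrow> real \<Rightarrow> 'a set \<Rightarrow> real" where
  "slice_term a t F = (if rel_interior F \<inter> {x. a \<bullet> x = t} = {} then 0
     else (-1) ^ nat (if F \<subseteq> {x. a \<bullet> x = t} then aff_dim F else aff_dim F - 1))"

lemma sum_slice_term:
  assumes "polyhedron P" "P \<inter> {x. a \<bullet> x = t} \<noteq> {}"
  shows "(\<Sum>F\<in>nfaces P. slice_term a t F) = (\<Sum>G\<in>nfaces (P \<inter> {x. a \<bullet> x = t}). face_sign G)"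
proof -
  have "(\<Sum>G\<in>nfaces (P \<inter> {x. a \<bullet> x = t}). face_sign G) =
    (\<Sum>F\<in>{F\<in>nfaces P. rel_interior F \<inter> {x. a \<bullet> x = t} \<noteq> {}}.
       (-1) ^ nat (if F \<subseteq> {x. a \<bullet> x = t} then aff_dim F else aff_dim F - 1))"
    unfolding face_sign_def by (rule sum_nfaces_hyperplane[OF assms])
  also have "\<dots> = (\<Sum>F\<in>nfaces P. if rel_interior F \<inter> {x. a \<bullet> x = t} \<noteq> {}
      then (-1) ^ nat (if F \<subseteq> {x. a \<bullet> x = t} then aff_dim F else aff_dim F - 1) else 0)"
    by (rule sum.inter_filter[OF finite_nfaces[OF assms(1)]])
  also have "\<dots> = (\<Sum>F\<in>nfaces P. slice_term a t F)"
    by (rule sum.cong[OF refl]) (simp add: slice_term_def)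
  finally show ?thesis by simp
qed

lemma slice_term_interval:
  fixes F :: "'a::euclidean_space set"
  assumes "convex F" "(\<bullet>) a ` F = {m..M}" "m \<le> M"
  shows "slice_term a t F = (if m = M then (if t = m then face_sign F else 0)
     else (if m < t \<and> t < M then - face_sign F else 0))"
proof -
  let ?H = "{x. a \<bullet> x = t}"
  have "F \<noteq> {}" using assms(2,3) by auto
  have "F \<subseteq> ?H \<longleftrightarrow> (\<bullet>) a ` F \<subseteq> {t}" by blast
  also have "\<dots> \<longleftrightarrow> {m..M} \<subseteq> {t..t}" unfolding assms(2) by simp
  also have "\<dots> \<longleftrightarrow> m = t \<and> M = t" using assms(3) by auto
  finally have sub: "F \<subseteq> ?H \<longleftrightarrow> m = t \<and> M = t" .
  note meets = rel_interior_meets_hyperplane_iff[OF assms(1,2), of t]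
  show ?thesis
  proof (cases "m = M")
    case True
    then show ?thesis using sub meets by (auto simp: slice_term_def face_sign_def)
  next
    case False
    \<comment> \<open>A face on which \<open>a\<close> varies is not a point, so
      \<open>aff_dim F - 1\<close> is nonnegative and \<open>nat\<close> does not truncate it; the
      section has exactly the opposite sign.\<close>
    have "aff_dim F \<noteq> 0"
    proof
      assume "aff_dim F = 0"
      then obtain z where "F = {z}" by (auto simp: aff_dim_eq_0)
      then have "{a \<bullet> z..a \<bullet> z} = {m..M}" using assms(2) by simp
      then show False using assms(3) False unfolding Icc_eq_Icc by simp
    qed
    then have "aff_dim F > 0" using \<open>F \<noteq> {}\<close> aff_dim_nonneg_iff[of F] by linarith
    then obtain k where "aff_dim F = int (Suc k)" by (metis Suc_pred' zero_less_imp_eq_int)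
    moreover have "\<not> F \<subseteq> ?H" using sub False by simp
    ultimately show ?thesis using meets False
      by (cases "m < t \<and> t < M") (simp_all add: slice_term_def face_sign_def nat_add_distrib)
  qed
qed

text \<open>Each face is counted over the heights in \<open>T\<close> minus the gap points. If
  \<open>a\<close> is constant on \<open>F\<close>, then \<open>F\<close> counts once, at its own
  height. Otherwise it counts with sign \<open>- face_sign F\<close> at each height strictly inside
  its range, and the range contains one more gap point than elements of \<open>T\<close>. Either way
  \<open>face_sign F\<close> remains.\<close>

lemma euler_relation:
  fixes P :: "'a::euclidean_space set"
  assumes "polytope P" "P \<noteq> {}"
  shows "(\<Sum>F\<in>nfaces P. face_sign F) = 1"
  using assms
proof (induction "nat (aff_dim P)" arbitrary: P rule: less_induct)
  case less
  note P = \<open>polytope P\<close> \<open>P \<noteq> {}\<close>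
  show ?case
  proof (cases "\<exists>x. P = {x}")
    case True
    then show ?thesis by (auto simp: nfaces_affine face_sign_def)
  next
    case False
    then obtain p q where pq: "p \<in> P" "q \<in> P" "p \<noteq> q" using P by blast
    \<comment> \<open>This direction puts \<open>p\<close> and \<open>q\<close> at different
      heights, so that no slice is all of \<open>P\<close>.\<close>
    define a where "a = q - p"
    have apq: "a \<bullet> p < a \<bullet> q"
      using pq(3) inner_gt_zero_iff[of "q - p"] by (simp add: a_def inner_diff_right)
    define m where "m F = Inf ((\<bullet>) a ` F)" for F
    define M where "M F = Sup ((\<bullet>) a ` F)" for F
    have mM: "m F \<le> M F" "(\<bullet>) a ` F = {m F..M F}" if F: "F \<in> nfaces P" for F
    proof -
      obtain l r where "l \<le> r" "(\<bullet>) a ` F = {l..r}"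
        using inner_image_interval[of F a] nfaces_polytope_compact[OF P(1) F] by metis
      then show "m F \<le> M F" "(\<bullet>) a ` F = {m F..M F}" by (simp_all add: m_def M_def)
    qed
    have fin: "finite (nfaces P)" using finite_nfaces[OF polytope_imp_polyhedron[OF P(1)]] .
    have PP: "P \<in> nfaces P" using P by (simp add: nfaces_def face_of_refl polytope_imp_convex)
    have slice: "(\<Sum>F\<in>nfaces P. slice_term a t F) = 1" if t: "t \<in> {m P..M P}" for t
    proof -
      let ?H = "{x. a \<bullet> x = t}"
      have H: "polytope (P \<inter> ?H)" by (rule polytope_Int_polyhedron[OF P(1) polyhedron_hyperplane])
      have "t \<in> (\<bullet>) a ` P" using t mM(2)[OF PP] by simp
      then have ne: "P \<inter> ?H \<noteq> {}" by blast
      \<comment> \<open>The affine hull of the slice misses \<open>p\<close> or \<open>q\<close>, so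
        its dimension is strictly smaller and the induction hypothesis applies.\<close>
      have "p \<notin> ?H \<or> q \<notin> ?H" using apq by auto
      moreover have "affine hull (P \<inter> ?H) \<subseteq> ?H"
      proof (rule hull_minimal)
        show "affine ?H" by (rule affine_hyperplane)
      qed simp
      moreover have "p \<in> affine hull P" "q \<in> affine hull P" using pq by (auto intro: hull_inc)
      moreover have "affine hull (P \<inter> ?H) \<subseteq> affine hull P" by (rule hull_mono[OF Int_lower1])
      ultimately have "affine hull (P \<inter> ?H) \<subset> affine hull P" by blast
      then have "aff_dim (P \<inter> ?H) < aff_dim P" by (rule aff_dim_psubset)
      moreover have "aff_dim (P \<inter> ?H) \<ge> 0" using ne aff_dim_nonneg_iff by metis
      ultimately have "(\<Sum>G\<in>nfaces (P \<inter> ?H). face_sign G) = 1"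
        by (intro less.hyps H ne) simp
      then show ?thesis using sum_slice_term[OF polytope_imp_polyhedron[OF P(1)] ne] by simp
    qed
    define T where "T = m ` nfaces P \<union> M ` nfaces P"
    have T: "finite T" "T \<noteq> {}" using fin PP by (auto simp: T_def)
    have mMP: "m P \<le> m F \<and> M F \<le> M P" if "F \<in> nfaces P" for F
    proof -
      have "F \<subseteq> P" using that face_of_imp_subset unfolding nfaces_def by blast
      then have "{m F..M F} \<subseteq> {m P..M P}" unfolding mM(2)[OF that, symmetric] mM(2)[OF PP, symmetric] by blast
      then show ?thesis using mM(1)[OF that] by simp
    qed
    have TI: "t \<in> {m P..M P}" if "t \<in> T" for t
    proof -
      from that obtain F where F: "F \<in> nfaces P" "t = m F \<or> t = M F" by (auto simp: T_def)
      then show ?thesis using mMP[OF F(1)] mM(1)[OF F(1)] by auto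
    qed
    obtain u where u: "\<And>t. t \<in> T - {Max T} \<Longrightarrow> t < u t \<and> u t < Max T \<and> u t \<notin> T"
      and gap: "\<And>m M. m \<in> T \<Longrightarrow> M \<in> T \<Longrightarrow> m < M \<Longrightarrow>
         card {t \<in> T - {Max T}. m < u t \<and> u t < M} = card {t \<in> T. m < t \<and> t < M} + 1"
      using card_gaps_between[OF T] by blast
    have 1: "(\<Sum>t\<in>T. \<Sum>F\<in>nfaces P. slice_term a t F) = real (card T)"
      using slice[OF TI] by simp
    have uI: "u t \<in> {m P..M P}" if "t \<in> T - {Max T}" for t
      using u[OF that] TI[of t] that TI[OF Max_in[OF T]] by auto
    have 2: "(\<Sum>t\<in>T - {Max T}. \<Sum>F\<in>nfaces P. slice_term a (u t) F) = real (card (T - {Max T}))"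
      using slice[OF uI] by simp
    have "card T = card (T - {Max T}) + 1"
      using card.remove[OF T(1) Max_in[OF T]] by simp
    then have "1 = (\<Sum>t\<in>T. \<Sum>F\<in>nfaces P. slice_term a t F)
        - (\<Sum>t\<in>T - {Max T}. \<Sum>F\<in>nfaces P. slice_term a (u t) F)"
      unfolding 1 2 by simp
    also have "\<dots> = (\<Sum>F\<in>nfaces P. (\<Sum>t\<in>T. slice_term a t F) - (\<Sum>t\<in>T - {Max T}. slice_term a (u t) F))"
      unfolding sum_subtractf
      by (rule arg_cong2[of _ _ _ _ "(-)"]; rule sum.swap)
    also have "\<dots> = (\<Sum>F\<in>nfaces P. face_sign F)"
    proof (intro sum.cong refl)
      fix F assume F: "F \<in> nfaces P"
      then have mT: "m F \<in> T" "M F \<in> T" by (auto simp: T_def)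
      note st = slice_term_interval[OF nfaces_convex[OF F] mM(2,1)[OF F]]
      show "(\<Sum>t\<in>T. slice_term a t F) - (\<Sum>t\<in>T - {Max T}. slice_term a (u t) F) = face_sign F"
      proof (cases "m F = M F")
        case True
        have "(\<Sum>t\<in>T. slice_term a t F) = (\<Sum>t\<in>T. if t = m F then face_sign F else 0)"
          unfolding st using True by simp
        also have "\<dots> = face_sign F" using T(1) mT(1) by simp
        finally have "(\<Sum>t\<in>T. slice_term a t F) = face_sign F" .
        \<comment> \<open>The height of \<open>F\<close> belongs to \<open>T\<close>, which the gap
          points avoid.\<close>
        moreover have "(\<Sum>t\<in>T - {Max T}. slice_term a (u t) F) = 0"
        proof (intro sum.neutral ballI)
          fix t assume "t \<in> T - {Max T}"
          then have "u t \<noteq> m F" using u mT(1) by metis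
          then show "slice_term a (u t) F = 0" unfolding st using True by simp
        qed
        ultimately show ?thesis by simp
      next
        case False
        then have "m F < M F" using mM(1)[OF F] by simp
        have "(\<Sum>t\<in>T. slice_term a t F) = (\<Sum>t\<in>{t\<in>T. m F < t \<and> t < M F}. - face_sign F)"
          unfolding st sum.inter_filter[OF T(1)] using False by simp
        moreover have "(\<Sum>t\<in>T - {Max T}. slice_term a (u t) F)
            = (\<Sum>t\<in>{t\<in>T - {Max T}. m F < u t \<and> u t < M F}. - face_sign F)"
          unfolding st sum.inter_filter[OF finite_Diff[OF T(1)]] using False by simp
        ultimately show ?thesis
          unfolding sum_constant gap[OF mT \<open>m F < M F\<close>] by (simp add: algebra_simps)
      qed
    qed
    finally show ?thesis by simp
  qed
qed

section \<open>Pyramids and truncated pyramids\<close>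

lemma pyramid_polytope: "polytope P \<Longrightarrow> polytope (convex hull (insert v P))"
  by (metis finite_insert hull_insert polytope_convex_hull polytope_def)

lemma aff_dim_pyramid:
  "v \<notin> affine hull P \<Longrightarrow> aff_dim (convex hull (insert v P)) = aff_dim (P::'a::euclidean_space set) + 1"
  by (simp add: aff_dim_convex_hull aff_dim_insert)

text \<open>The empty face is included throughout: its pyramid is the apex, of dimension -1 + 1. The
  two families are disjoint because only the second contains \<open>v\<close>.\<close>

lemma pyramid_faces:
  fixes P :: "'a::euclidean_space set"
  assumes "polytope P" "v \<notin> affine hull P"
  shows "{G. G face_of convex hull (insert v P)} =
      {F. F face_of P} \<union> (\<lambda>F. convex hull (insert v F)) ` {F. F face_of P}"
    and "{F. F face_of P} \<inter> (\<lambda>F. convex hull (insert v F)) ` {F. F face_of P} = {}"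
    and "inj_on (\<lambda>F. convex hull (insert v F)) {F. F face_of P}"
    and "F face_of P \<Longrightarrow> aff_dim (convex hull (insert v F)) = aff_dim F + 1"
proof -
  let ?Q = "convex hull (insert v P)" and ?c = "\<lambda>F. convex hull (insert v F)"
  obtain V where V: "finite V" "P = convex hull V" using assms(1) by (auto simp: polytope_def)
  then have vV: "v \<notin> affine hull V" using assms(2) by simp
  have Q: "?Q = convex hull (insert v V)" using V(2) hull_insert by metis
  show 1: "{G. G face_of ?Q} = {F. F face_of P} \<union> ?c ` {F. F face_of P}"
    unfolding Q face_of_convex_hull_insert_eq[OF V(1) vV] V(2)[symmetric] by auto
  have vP: "v \<notin> P" using assms(2) hull_inc by metis
  then show "{F. F face_of P} \<inter> ?c ` {F. F face_of P} = {}"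
    by (auto dest!: face_of_imp_subset intro: hull_inc)
  show dim: "aff_dim (?c F) = aff_dim F + 1" if "F face_of P" for F
  proof -
    have "v \<notin> affine hull F" using assms(2) hull_mono[OF face_of_imp_subset[OF that]] by blast
    then show ?thesis by (simp add: aff_dim_convex_hull aff_dim_insert)
  qed
  \<comment> \<open>The base recovers \<open>F\<close>: the intersection is a proper face of the
    pyramid over \<open>F\<close>, so its dimension is at most that of \<open>F\<close>, and
    \<open>F\<close> is a face of it.\<close>
  have "?c F \<inter> P = F" if F: "F face_of P" for F
  proof -
    have "P face_of P" using assms(1) face_of_refl polytope_imp_convex by blast
    then have "P face_of ?Q" "?c F face_of ?Q" using 1 F by auto
    then have "(?c F \<inter> P) face_of ?Q" using face_of_Int by blast
    then have "(?c F \<inter> P) face_of ?c F"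
      by (rule face_of_subset) (use \<open>?c F face_of ?Q\<close> face_of_imp_subset in auto)
    moreover have "?c F \<inter> P \<noteq> ?c F" using vP hull_inc[of v "insert v F" convex] by auto
    ultimately have "aff_dim (?c F \<inter> P) \<le> aff_dim F"
      using face_of_aff_dim_lt[of "?c F" "?c F \<inter> P"] dim[OF F] by simp
    moreover have "F face_of (?c F \<inter> P)"
      by (rule face_of_subset[OF F]) (use face_of_imp_subset[OF F] hull_subset[of "insert v F" convex] in auto)
    moreover have "convex (?c F \<inter> P)"
      using assms(1) by (intro convex_Int convex_convex_hull polytope_imp_convex)
    ultimately show ?thesis using face_of_aff_dim_lt[of "?c F \<inter> P" F] by fastforce
  qed
  then show "inj_on ?c {F. F face_of P}" by (metis (mono_tags, lifting) inj_onI mem_Collect_eq)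
qed

lemma sum_pyramid_faces:
  fixes P :: "'a::euclidean_space set" and g :: "'a set \<Rightarrow> real"
  assumes "polytope P" "v \<notin> affine hull P"
  shows "(\<Sum>G | G face_of convex hull (insert v P). g G) =
    (\<Sum>F | F face_of P. g F + g (convex hull (insert v F)))"
  unfolding pyramid_faces(1)[OF assms]
  using finite_polytope_faces[OF assms(1)] pyramid_faces(2,3)[OF assms]
  by (subst sum.union_disjoint) (auto simp: sum.reindex sum.distrib)

lemma sum_nfaces:
  assumes "polytope P"
  shows "(\<Sum>F\<in>nfaces P. g F) = (\<Sum>F | F face_of P. if F = {} then 0 else g F)"
proof -
  have "nfaces P = {F\<in>{F. F face_of P}. \<not> F = {}}" by (auto simp: nfaces_def)
  then show ?thesis
    using finite_polytope_faces[OF assms] by (simp add: sum.inter_filter if_distrib cong: if_cong) (simp add: sum.If_cases Int_def)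
qed

section \<open>A face invariant that distinguishes pyramids from truncated pyramids\<close>

text \<open>Up to sign, the derivative at -1 of the polynomial in which each nonempty face
  contributes the power of its dimension; its value at -1 is the Euler characteristic.\<close>

definition weighted_sum :: "'a::euclidean_space set \<Rightarrow> real" where
  "weighted_sum P = (\<Sum>F\<in>nfaces P. real_of_int (aff_dim F) * face_sign F)"

lemma face_sign_pyramid:
  assumes "polytope P" "v \<notin> affine hull P" "F \<in> nfaces P"
  shows "face_sign (convex hull (insert v F)) = - face_sign F"
proof -
  have "aff_dim F \<ge> 0" using assms(3) by (auto simp: nfaces_def aff_dim_nonneg_iff)
  then show ?thesis using assms
    by (simp add: face_sign_def pyramid_faces(4) nfaces_def nat_add_distrib)
qed

text \<open>A face of dimension \<open>k\<close> and sign \<open>s\<close> and the pyramid over it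
  contribute \<open>k * s - (k + 1) * s = - s\<close>. The apex contributes 0, so minus the Euler
  sum of \<open>P\<close> is left.\<close>

lemma weighted_sum_pyramid:
  fixes P :: "'a::euclidean_space set"
  assumes "polytope P" "P \<noteq> {}" "v \<notin> affine hull P"
  shows "weighted_sum (convex hull (insert v P)) = -1"
proof -
  have "weighted_sum (convex hull (insert v P)) =
     (\<Sum>F | F face_of P. (if F = {} then 0 else real_of_int (aff_dim F) * face_sign F) +
       real_of_int (aff_dim (convex hull (insert v F))) * face_sign (convex hull (insert v F)))"
    unfolding weighted_sum_def sum_nfaces[OF pyramid_polytope[OF assms(1)]]
      sum_pyramid_faces[OF assms(1,3)] by (intro sum.cong) auto
  also have "\<dots> = (\<Sum>F | F face_of P. if F = {} then 0 else - face_sign F)"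
  proof (intro sum.cong refl)
    fix F assume F: "F \<in> {F. F face_of P}"
    show "(if F = {} then 0 else real_of_int (aff_dim F) * face_sign F) +
       real_of_int (aff_dim (convex hull (insert v F))) * face_sign (convex hull (insert v F)) =
       (if F = {} then 0 else - face_sign F)"
      using F face_sign_pyramid[OF assms(1,3), of F] pyramid_faces(4)[OF assms(1,3), of F]
      by (auto simp: nfaces_def algebra_simps)
  qed
  also have "\<dots> = - (\<Sum>F\<in>nfaces P. face_sign F)"
    by (simp add: sum_nfaces[OF assms(1)] sum_negf[symmetric] if_distrib cong: if_cong)
  finally show ?thesis using euler_relation[OF assms(1,2)] by simp
qed

text \<open>Cut off the apex by a hyperplane separating it from \<open>B\<close>. A face of
  \<open>B\<close> of dimension \<open>k\<close> and sign \<open>s\<close> survives, the pyramid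
  over it leaves a truncated part of dimension \<open>k + 1\<close>, and the cut adds a section of
  dimension \<open>k\<close>. Together they contribute
  \<open>k * s - (k + 1) * s + k * s = k * s - s\<close>.\<close>

lemma truncated_pyramid:
  fixes B :: "'a::euclidean_space set"
  assumes B: "polytope B" "B \<noteq> {}" and v: "v \<notin> affine hull B"
  obtains Q :: "'a set" where "polytope Q" "aff_dim Q = aff_dim B + 1" "weighted_sum Q = weighted_sum B - 1"
proof -
  let ?P = "convex hull (insert v B)"
  have "v \<notin> B" using v hull_inc by metis
  then obtain a b where ab: "a \<bullet> v < b" "\<And>x. x \<in> B \<Longrightarrow> b < a \<bullet> x"
    using separating_hyperplane_closed_point[of B v] B polytope_imp_convex polytope_imp_closed by blast
  let ?H = "{x. a \<bullet> x = b}" and ?O = "{x. a \<bullet> x > b}"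
  obtain x0 where x0: "x0 \<in> B" using B by blast
  have "a \<noteq> 0" using ab(1) ab(2)[OF x0] by auto
  have P: "polytope ?P" by (rule pyramid_polytope[OF B(1)])
  have fin: "finite (nfaces ?P)" using P polytope_imp_polyhedron finite_nfaces by blast
  let ?Q = "?P \<inter> {x. a \<bullet> x \<ge> b}"
  have Q: "polytope ?Q" using P by (simp add: polytope_Int_polyhedron polyhedron_halfspace_ge)
  \<comment> \<open>The open half-space meets the closure of the relative interior in
    \<open>x0\<close>, hence it meets the relative interior itself.\<close>
  have "x0 \<in> ?O \<inter> closure (rel_interior ?P)"
    using ab(2)[OF x0] x0 hull_inc[of x0 "insert v B" convex] closure_subset[of ?P]
    by (auto simp: convex_closure_rel_interior)
  then have "rel_interior ?P \<inter> ?O \<noteq> {}"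
    using open_Int_closure_eq_empty[OF open_halfspace_gt[of b a], of "rel_interior ?P"] by auto
  then have "aff_dim ?Q = aff_dim ?P"
    by (intro aff_dim_Int_open[of _ ?O] open_halfspace_gt) auto
  also have "\<dots> = aff_dim B + 1"
    by (rule pyramid_faces(4)[OF B(1) v face_of_refl[OF polytope_imp_convex[OF B(1)]]])
  finally have dimQ: "aff_dim ?Q = aff_dim B + 1" .
  define h where "h k = real_of_int k * (-1) ^ nat k" for k
  define g where "g F = (if rel_interior F \<inter> ?O \<noteq> {} then h (aff_dim F) else 0) +
      (if rel_interior F \<inter> ?H \<noteq> {} then h (if F \<subseteq> ?H then aff_dim F else aff_dim F - 1) else 0)" for F
  have "weighted_sum ?Q = (\<Sum>G\<in>nfaces ?Q. h (aff_dim G))"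
    by (simp add: weighted_sum_def h_def face_sign_def)
  also have "\<dots> = (\<Sum>F\<in>nfaces ?P. g F)"
    unfolding sum_nfaces_halfspace[OF polytope_imp_polyhedron[OF P] \<open>a \<noteq> 0\<close>] sum.inter_filter[OF fin]
    by (simp only: g_def sum.distrib)
  also have "\<dots> = (\<Sum>F | F face_of ?P. g F)"
    unfolding sum_nfaces[OF P] by (intro sum.cong) (auto simp: g_def)
  also have "\<dots> = (\<Sum>F | F face_of B. g F + g (convex hull (insert v F)))"
    by (rule sum_pyramid_faces[OF B(1) v])
  also have "\<dots> = (\<Sum>F | F face_of B. if F = {} then 0 else real_of_int (aff_dim F) * face_sign F - face_sign F)"
  proof (intro sum.cong refl)
    fix F assume "F \<in> {F. F face_of B}"
    then have F: "F face_of B" by simp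
    let ?G = "convex hull (insert v F)"
    show "g F + g ?G = (if F = {} then 0 else real_of_int (aff_dim F) * face_sign F - face_sign F)"
    proof (cases "F = {}")
      case True
      \<comment> \<open>The empty face corresponds to the apex, which lies strictly on the discarded
        side.\<close>
      then show ?thesis using ab(1) by (auto simp: g_def)
    next
      case False
      then have nF: "F \<in> nfaces B" using F by (simp add: nfaces_def)
      have FB: "F \<subseteq> B" using F face_of_imp_subset by blast
      have "rel_interior F \<noteq> {}"
        using False F face_of_imp_convex rel_interior_eq_empty by blast
      moreover have "rel_interior F \<subseteq> ?O" using FB ab(2) rel_interior_subset by blast
      ultimately have "rel_interior F \<inter> ?O \<noteq> {}" "rel_interior F \<inter> ?H = {}" by auto
      then have gF: "g F = h (aff_dim F)" by (simp add: g_def)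
      obtain y where y: "y \<in> F" using False by blast
      have G: "compact ?G" "convex ?G" "?G \<noteq> {}"
        using F B(1) by (auto intro!: compact_convex_hull compact_insert simp: face_of_polytope_polytope polytope_imp_compact)
      obtain m M where mM: "(\<bullet>) a ` ?G = {m..M}" using inner_image_interval[OF G] by blast
      have "a \<bullet> v \<in> {m..M}" "a \<bullet> y \<in> {m..M}"
        unfolding mM[symmetric] using y by (auto intro: hull_inc)
      moreover have "b < a \<bullet> y" using y FB ab(2) by blast
      ultimately have *: "m < b" "b < M" using ab(1) by auto
      have H: "rel_interior ?G \<inter> ?H \<noteq> {}"
        using rel_interior_meets_hyperplane_iff[OF G(2) mM, of b] * by simp
      \<comment> \<open>Any height strictly between \<open>b\<close> and \<open>M\<close> shows that
        the relative interior enters the open half-space.\<close>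
      have "rel_interior ?G \<inter> {x. a \<bullet> x = (b + M) / 2} \<noteq> {}"
        using rel_interior_meets_hyperplane_iff[OF G(2) mM, of "(b + M) / 2"] * by simp
      then have "rel_interior ?G \<inter> ?O \<noteq> {}" using * by force
      moreover have "\<not> ?G \<subseteq> ?H" using ab(1) hull_inc[of v "insert v F" convex] by auto
      ultimately have "g ?G = h (aff_dim ?G) + h (aff_dim ?G - 1)" using H by (simp add: g_def)
      moreover have "aff_dim F \<ge> 0" using False by (simp add: aff_dim_nonneg_iff)
      ultimately show ?thesis
        using False gF pyramid_faces(4)[OF B(1) v F]
        by (simp add: h_def face_sign_def nat_add_distrib algebra_simps)
    qed
  qed
  also have "\<dots> = (\<Sum>F\<in>nfaces B. real_of_int (aff_dim F) * face_sign F - face_sign F)"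
    by (simp add: sum_nfaces[OF B(1)])
  also have "\<dots> = weighted_sum B - 1"
    using euler_relation[OF B] by (simp add: weighted_sum_def sum_subtractf)
  finally show thesis by (rule that[OF Q dimQ])
qed

lemma exists_apex:
  fixes P :: "'a::euclidean_space set"
  assumes "aff_dim P < int DIM('a)"
  obtains v where "v \<notin> affine hull P"
  using assms aff_dim_eq_full[of P] by auto

text \<open>Iterated pyramids over a point; the bound on \<open>d\<close> leaves room for each new
  apex.\<close>

lemma exists_polytope:
  assumes "d \<le> DIM('a::euclidean_space)"
  shows "\<exists>P::'a set. polytope P \<and> aff_dim P = int d"
  using assms
proof (induction d)
  case 0
  show ?case by (rule exI[of _ "{0}"]) (simp add: polytope_sing)
next
  case (Suc d)
  then obtain P :: "'a set" where P: "polytope P" "aff_dim P = int d" by auto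
  then obtain v where "v \<notin> affine hull P" using exists_apex[of P] Suc.prems by auto
  then have "aff_dim (convex hull (insert v P)) = int (Suc d)"
    using P by (simp add: aff_dim_convex_hull aff_dim_insert)
  then show ?case using pyramid_polytope[OF P(1)] by blast
qed

section \<open>The lattice of f-vectors\<close>

text \<open>Groups the proper nonempty faces by dimension. The f-vector stops at
  \<open>d - 1\<close>, so the term \<open>w d\<close> of \<open>P\<close> itself is taken
  off.\<close>

lemma sum_f_vector:
  fixes P :: "'a::euclidean_space set"
  assumes "polytope P" "aff_dim P = int d"
  shows "(\<Sum>i<d. w i * f_vector d P i) = (\<Sum>F\<in>nfaces P. w (nat (aff_dim F))) - w d"
proof -
  have fin: "finite (nfaces P)" using finite_nfaces[OF polytope_imp_polyhedron[OF assms(1)]] .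
  have conv: "convex P" using assms(1) polytope_imp_convex by blast
  have "P \<noteq> {}" using assms(2) by auto
  then have PP: "P \<in> nfaces P" using conv by (simp add: nfaces_def face_of_refl)
  let ?N = "nfaces P - {P}"
  have lt: "0 \<le> aff_dim F \<and> aff_dim F < int d" if "F \<in> ?N" for F
    using that face_of_aff_dim_lt[OF conv, of F] assms(2) by (auto simp: nfaces_def aff_dim_nonneg_iff)
  have "{F. F face_of P \<and> aff_dim F = int i} = {F\<in>?N. nat (aff_dim F) = i}" if "i < d" for i
  proof (intro set_eqI iffI)
    fix F assume "F \<in> {F. F face_of P \<and> aff_dim F = int i}"
    then show "F \<in> {F\<in>?N. nat (aff_dim F) = i}"
      using that assms(2) by (auto simp: nfaces_def)
  next
    fix F assume "F \<in> {F\<in>?N. nat (aff_dim F) = i}"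
    then show "F \<in> {F. F face_of P \<and> aff_dim F = int i}"
      using lt[of F] by (auto simp: nfaces_def)
  qed
  then have "(\<Sum>i<d. w i * f_vector d P i) = (\<Sum>i<d. \<Sum>F\<in>{F\<in>?N. nat (aff_dim F) = i}. w (nat (aff_dim F)))"
    by (intro sum.cong refl) (simp add: f_vector_def)
  also have "\<dots> = (\<Sum>F\<in>?N. w (nat (aff_dim F)))"
  proof (rule sum.group)
    have "nat (aff_dim F) < d" if "F \<in> ?N" for F using lt[OF that] by linarith
    then show "(\<lambda>F. nat (aff_dim F)) ` ?N \<subseteq> {..<d}" by blast
  qed (use fin in auto)
  also have "\<dots> = (\<Sum>F\<in>nfaces P. w (nat (aff_dim F))) - w d"
    using sum.remove[OF fin PP, of "\<lambda>F. w (nat (aff_dim F))"] assms(2) by simp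
  finally show ?thesis .
qed

lemma f_vector_in_f_vectors:
  "polytope (P::'a::euclidean_space set) \<Longrightarrow> aff_dim P = int d \<Longrightarrow> f_vector d P \<in> f_vectors TYPE('a) d"
  unfolding f_vectors_def by blast

lemma f_vector_euler:
  fixes P :: "'a::euclidean_space set"
  assumes "polytope P" "aff_dim P = int d"
  shows "f_vector d P \<in> euler_hyperplane d \<inter> int_lattice d"
proof -
  have "P \<noteq> {}" using assms(2) by auto
  from euler_relation[OF assms(1) this]
  have "(\<Sum>i<d. (-1) ^ i * f_vector d P i) = 1 - (-1) ^ d"
    unfolding sum_f_vector[OF assms] by (simp add: face_sign_def)
  then show ?thesis
    by (simp add: euler_hyperplane_def int_lattice_def real_space_def f_vector_def)
qed

section \<open>Integral affine combinations\<close>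

lemma int_affine_hull_subset_euler:
  assumes "S \<subseteq> euler_hyperplane d \<inter> int_lattice d"
  shows "int_affine_hull S \<subseteq> euler_hyperplane d \<inter> int_lattice d"
proof
  fix x assume "x \<in> int_affine_hull S"
  then obtain n :: nat and v and a :: "nat \<Rightarrow> int" where v: "\<And>k. k \<in> {1..n} \<Longrightarrow> v k \<in> S"
    and a: "(\<Sum>k=1..n. a k) = 1" and x: "x = (\<lambda>i. \<Sum>k=1..n. of_int (a k) * v k i)"
    unfolding int_affine_hull_def by blast
  have v': "v k \<in> euler_hyperplane d \<inter> int_lattice d" if "k \<in> {1..n}" for k
    using v[OF that] assms by blast
  have "x i = 0" if "i \<ge> d" for i
    unfolding x using v' that by (intro sum.neutral) (auto simp: euler_hyperplane_def real_space_def)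
  moreover have "x i \<in> \<int>" if "i < d" for i
    unfolding x using v' that by (intro Ints_sum Ints_mult Ints_of_int) (auto simp: int_lattice_def)
  moreover have "(\<Sum>i<d. (-1) ^ i * x i) = 1 - (-1) ^ d"
  proof -
    have "(\<Sum>i<d. (-1) ^ i * x i) = (\<Sum>i<d. \<Sum>k=1..n. of_int (a k) * ((-1) ^ i * v k i))"
      unfolding x by (simp add: sum_distrib_left mult_ac)
    also have "\<dots> = (\<Sum>k=1..n. of_int (a k) * (\<Sum>i<d. (-1) ^ i * v k i))"
      by (subst sum.swap) (simp add: sum_distrib_left)
    also have "\<dots> = (\<Sum>k=1..n. of_int (a k) * (1 - (-1) ^ d))"
      using v' by (intro sum.cong) (auto simp: euler_hyperplane_def)
    also have "\<dots> = of_int (\<Sum>k=1..n. a k) * (1 - (-1) ^ d)"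
      by (simp add: sum_distrib_right)
    finally show ?thesis unfolding a by simp
  qed
  ultimately show "x \<in> euler_hyperplane d \<inter> int_lattice d"
    by (simp add: euler_hyperplane_def int_lattice_def real_space_def)
qed

lemma int_affine_hull_inc: "x \<in> S \<Longrightarrow> x \<in> int_affine_hull S"
  unfolding int_affine_hull_def
  by (rule CollectI, rule exI[of _ 1], rule exI[of _ "\<lambda>_. x"], rule exI[of _ "\<lambda>_. 1"]) simp

text \<open>Appending \<open>y\<close> and \<open>z\<close> with coefficients \<open>c\<close> and
  \<open>- c\<close> leaves the coefficient sum at 1.\<close>

lemma int_affine_hull_add_diff:
  assumes "x \<in> int_affine_hull S" "y \<in> S" "z \<in> S"
  shows "(\<lambda>i. x i + of_int c * (y i - z i)) \<in> int_affine_hull S"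
proof -
  obtain n :: nat and v and a :: "nat \<Rightarrow> int" where n: "n \<ge> 1" and v: "\<And>k. k \<in> {1..n} \<Longrightarrow> v k \<in> S"
    and a: "(\<Sum>k=1..n. a k) = 1" and x: "x = (\<lambda>i. \<Sum>k=1..n. of_int (a k) * v k i)"
    using assms(1) unfolding int_affine_hull_def by blast
  define v' where "v' = v(Suc n := y, Suc (Suc n) := z)"
  define a' where "a' = a(Suc n := c, Suc (Suc n) := - c)"
  have "\<forall>k\<in>{1..Suc (Suc n)}. v' k \<in> S"
    using v assms by (auto simp: v'_def)
  moreover have "(\<Sum>k=1..Suc (Suc n). a' k) = 1"
  proof -
    have "(\<Sum>k=1..n. a' k) = (\<Sum>k=1..n. a k)" by (intro sum.cong) (auto simp: a'_def)
    then show ?thesis using a by (simp add: a'_def)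
  qed
  moreover have "(\<lambda>i. x i + of_int c * (y i - z i)) = (\<lambda>i. \<Sum>k=1..Suc (Suc n). of_int (a' k) * v' k i)"
  proof
    fix i
    have "(\<Sum>k=1..n. of_int (a' k) * v' k i) = (\<Sum>k=1..n. of_int (a k) * v k i)"
      by (intro sum.cong) (auto simp: a'_def v'_def)
    then show "x i + of_int c * (y i - z i) = (\<Sum>k=1..Suc (Suc n). of_int (a' k) * v' k i)"
      unfolding x by (simp add: a'_def v'_def algebra_simps)
  qed
  ultimately show ?thesis
    unfolding int_affine_hull_def by (intro CollectI exI[of _ "Suc (Suc n)"] exI[of _ v'] exI[of _ a']) simp
qed

section \<open>The action of pyramids on f-vectors\<close>

text \<open>The two constants are \<open>f\<^sub>d(P) = 1\<close>, for \<open>P\<close> itself, and \<open>f\<^sub>-\<^sub>1(P) = 1\<close>, for the empty face.\<close>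

definition pyramid_map :: "nat \<Rightarrow> (nat \<Rightarrow> real) \<Rightarrow> nat \<Rightarrow> real" where
  "pyramid_map d x i =
     (if i \<le> d then (if i = d then 1 else x i) + (if i = 0 then 1 else x (i - 1)) else 0)"

lemma f_vector_pyramid:
  fixes P :: "'a::euclidean_space set"
  assumes "polytope P" "aff_dim P = int d" "v \<notin> affine hull P"
  shows "f_vector (Suc d) (convex hull (insert v P)) = pyramid_map d (f_vector d P)"
proof
  fix i
  \<comment> \<open>Integer dimensions make the recursion uniform: the empty face at -1 and
    \<open>P\<close> at \<open>d\<close> supply the boundary values.\<close>
  define N :: "'a set \<Rightarrow> int \<Rightarrow> real" where "N R k = real (card {F. F face_of R \<and> aff_dim F = k})" for R k
  have N: "N R k = (\<Sum>F | F face_of R. if aff_dim F = k then 1 else 0)" if "polytope R" for R k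
    using finite_polytope_faces[OF that] by (simp add: N_def sum.If_cases Int_def)
  have "N (convex hull (insert v P)) k =
      (\<Sum>F | F face_of P. (if aff_dim F = k then 1 else 0) + (if aff_dim F = k - 1 then 1 else 0))" for k
    unfolding N[OF pyramid_polytope[OF assms(1)]] sum_pyramid_faces[OF assms(1,3)]
    using pyramid_faces(4)[OF assms(1,3)] by (intro sum.cong) auto
  then have rec: "N (convex hull (insert v P)) k = N P k + N P (k - 1)" for k
    by (simp add: N[OF assms(1)] sum.distrib)
  have conv: "convex P" using assms(1) polytope_imp_convex by blast
  have "{F. F face_of P \<and> aff_dim F = int d} = {P}"
    using assms(2) face_of_aff_dim_lt[OF conv] face_of_refl[OF conv] by fastforce
  then have top: "N P (int d) = 1" by (simp add: N_def)
  have "{F. F face_of P \<and> aff_dim F = -1} = {{}}" using aff_dim_empty by blast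
  then have bot: "N P (-1) = 1" by (simp add: N_def)
  show "f_vector (Suc d) (convex hull (insert v P)) i = pyramid_map d (f_vector d P) i"
  proof (cases "i \<le> d")
    case True
    have "f_vector (Suc d) (convex hull (insert v P)) i = N (convex hull (insert v P)) (int i)"
      using True by (simp add: f_vector_def N_def)
    also have "\<dots> = N P (int i) + N P (int i - 1)" by (rule rec)
    also have "N P (int i) = (if i = d then 1 else f_vector d P i)"
      using top True by (simp add: f_vector_def N_def)
    also have "N P (int i - 1) = (if i = 0 then 1 else f_vector d P (i - 1))"
      using bot True by (auto simp: f_vector_def N_def of_nat_diff)
    finally show ?thesis using True by (simp add: pyramid_map_def)
  next
    case False
    then show ?thesis by (simp add: f_vector_def pyramid_map_def)
  qed
qed

lemma pyramid_map_hull: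
  assumes "Suc d \<le> DIM('a::euclidean_space)"
    and "x \<in> int_affine_hull (f_vectors TYPE('a) d)"
  shows "pyramid_map d x \<in> int_affine_hull (f_vectors TYPE('a) (Suc d))"
proof -
  obtain n :: nat and v and a :: "nat \<Rightarrow> int" where n: "n \<ge> 1"
    and v: "\<And>k. k \<in> {1..n} \<Longrightarrow> v k \<in> f_vectors TYPE('a) d"
    and a: "(\<Sum>k=1..n. a k) = 1" and x: "x = (\<lambda>i. \<Sum>k=1..n. of_int (a k) * v k i)"
    using assms(2) unfolding int_affine_hull_def by blast
  have "pyramid_map d (v k) \<in> f_vectors TYPE('a) (Suc d)" if k: "k \<in> {1..n}" for k
  proof -
    obtain P :: "'a set" where P: "polytope P" "aff_dim P = int d" "v k = f_vector d P"
      using v[OF k] by (auto simp: f_vectors_def)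
    then obtain w where w: "w \<notin> affine hull P" using exists_apex[of P] assms(1) by auto
    then have "aff_dim (convex hull (insert w P)) = int (Suc d)"
      using P by (simp add: aff_dim_convex_hull aff_dim_insert)
    then show ?thesis
      unfolding f_vectors_def P(3)
      by (intro CollectI exI[of _ "convex hull (insert w P)"])
        (simp add: f_vector_pyramid[OF P(1,2) w] pyramid_polytope[OF P(1)])
  qed
  moreover have "pyramid_map d x = (\<lambda>i. \<Sum>k=1..n. of_int (a k) * pyramid_map d (v k) i)"
  proof
    fix i
    \<comment> \<open>The constant entries of \<open>pyramid_map\<close> are reproduced precisely
      because the coefficients sum to 1.\<close>
    have 1: "(\<Sum>k=1..n. real_of_int (a k)) = 1" using a by (metis of_int_1 of_int_sum)
    show "pyramid_map d x i = (\<Sum>k=1..n. of_int (a k) * pyramid_map d (v k) i)"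
      unfolding pyramid_map_def x using 1 by (simp add: distrib_left sum.distrib)
  qed
  ultimately show ?thesis
    using n a unfolding int_affine_hull_def
    by (intro CollectI exI[of _ n] exI[of _ "\<lambda>k. pyramid_map d (v k)"] exI[of _ a]) simp
qed

text \<open>
  The functional that recognises pyramids: inverting the pyramid map forces \<open>z i\<close> to be an
  alternating partial sum, and the Euler equation for \<open>z\<close> becomes a condition on this weight.
\<close>

definition euler_weight :: "nat \<Rightarrow> (nat \<Rightarrow> real) \<Rightarrow> real" where
  "euler_weight d x = (\<Sum>i<d. (real d - real i) * (-1) ^ i * x i)"

text \<open>Converts the invariant of polytopes into a functional of f-vectors. The value -1 taken
  by pyramids becomes \<open>real d + 1 - (-1) ^ d\<close>.\<close>

lemma euler_weight_f_vector:
  fixes P :: "'a::euclidean_space set"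
  assumes "polytope P" "aff_dim P = int (Suc d)"
  shows "euler_weight d (f_vector (Suc d) P) = real d - (-1) ^ d - weighted_sum P"
proof -
  have "P \<noteq> {}" using assms(2) by auto
  have "euler_weight d (f_vector (Suc d) P) = (\<Sum>i<Suc d. (real d - real i) * (-1) ^ i * f_vector (Suc d) P i)"
    by (simp add: euler_weight_def)
  \<comment> \<open>The coefficient vanishes at \<open>i = d\<close>, and at dimension
    \<open>Suc d\<close> it is -1, so the correction for \<open>P\<close> itself is
    \<open>(-1) ^ d\<close>.\<close>
  also have "\<dots> = (\<Sum>F\<in>nfaces P. (real d - real (nat (aff_dim F))) * (-1) ^ nat (aff_dim F)) - (-1) ^ d"
    unfolding sum_f_vector[OF assms] by simp
  also have "(\<Sum>F\<in>nfaces P. (real d - real (nat (aff_dim F))) * (-1) ^ nat (aff_dim F)) =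
      (\<Sum>F\<in>nfaces P. real d * face_sign F - real_of_int (aff_dim F) * face_sign F)"
    by (intro sum.cong refl) (auto simp: nfaces_def aff_dim_nonneg_iff face_sign_def algebra_simps)
  also have "\<dots> = real d - weighted_sum P"
    using euler_relation[OF assms(1) \<open>P \<noteq> {}\<close>]
    by (simp add: sum_subtractf weighted_sum_def sum_distrib_left[symmetric])
  finally show ?thesis by simp
qed

text \<open>The term of index \<open>k\<close> occurs in the partial sums for
  \<open>i = k, ..., d - 1\<close>, that is, \<open>d - k\<close> times.\<close>

lemma euler_weight_triangle:
  "(\<Sum>i<d. \<Sum>k\<le>i. (-1) ^ k * x k) = euler_weight d x"
proof (induction d)
  case (Suc d)
  have "euler_weight (Suc d) x = euler_weight d x + (\<Sum>k\<le>d. (-1) ^ k * x k)"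
    by (simp add: euler_weight_def sum.distrib[symmetric] lessThan_Suc_atMost[symmetric] algebra_simps)
  then show ?case using Suc by simp
qed (simp add: euler_weight_def)

text \<open>Solves \<open>y i = z i + z (i - 1)\<close> upwards from the boundary value 1 in place
  of the entry of index -1. The Euler equation for \<open>y\<close> yields the other boundary value
  1 at \<open>d\<close>, and the weight condition yields the Euler equation for
  \<open>z\<close>.\<close>

lemma pyramid_map_surj:
  assumes y: "y \<in> euler_hyperplane (Suc d) \<inter> int_lattice (Suc d)"
    and w: "euler_weight d y = real d + 1 - (-1) ^ d"
  obtains z where "z \<in> euler_hyperplane d \<inter> int_lattice d" "pyramid_map d z = y"
proof -
  define s where "s i = (\<Sum>k\<le>i. (-1) ^ k * y k)" for i
  define z where "z i = (if i < d then (-1) ^ i * (s i - 1) else 0)" for i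
  have yi: "y i \<in> \<int>" for i
    using y by (cases "i < Suc d") (auto simp: int_lattice_def real_space_def)
  have sd: "s d = 1 + (-1) ^ d"
    using y by (simp add: s_def euler_hyperplane_def lessThan_Suc_atMost)
  have rec: "s i = s (i - 1) + (-1) ^ i * y i" if "i > 0" for i
    using that by (cases i) (auto simp: s_def)
  have z0: "z i = 0" if "i \<ge> d" for i using that by (simp add: z_def)
  have "z i \<in> \<int>" for i
    using yi by (auto simp: z_def s_def intro!: Ints_mult Ints_diff Ints_sum Ints_power)
  moreover have "(\<Sum>i<d. (-1) ^ i * z i) = 1 - (-1) ^ d"
  proof -
    have "(\<Sum>i<d. (-1) ^ i * z i) = (\<Sum>i<d. s i - 1)"
      by (intro sum.cong) (auto simp: z_def mult.assoc[symmetric] power_mult_distrib[symmetric])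
    also have "\<dots> = euler_weight d y - real d"
      by (simp add: sum_subtractf s_def euler_weight_triangle)
    finally show ?thesis using w by simp
  qed
  ultimately have z: "z \<in> euler_hyperplane d \<inter> int_lattice d"
    using z0 by (simp add: euler_hyperplane_def int_lattice_def real_space_def)
  have sign: "(-1) ^ i * ((-1) ^ i * r) = (r::real)" for i r
    by (simp add: mult.assoc[symmetric] power_mult_distrib[symmetric])
  \<comment> \<open>At \<open>i = d\<close> the closed formula gives
    \<open>(-1) ^ d * (-1) ^ d = 1\<close>, the constant entry in
    \<open>pyramid_map\<close>.\<close>
  have zd: "(if i = d then 1 else z i) = (-1) ^ i * (s i - 1)" if "i \<le> d" for i
    using that sd by (auto simp: z_def power_mult_distrib[symmetric])
  have pz: "pyramid_map d z = y"
  proof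
    fix i
    consider "i > d" | "i = 0" | "0 < i" "i \<le> d" by linarith
    then show "pyramid_map d z i = y i"
    proof cases
      case 1
      then show ?thesis using y by (simp add: pyramid_map_def euler_hyperplane_def real_space_def)
    next
      case 2
      then show ?thesis using zd[of 0] by (simp add: pyramid_map_def s_def)
    next
      case 3
      have "pyramid_map d z i = (-1) ^ i * (s i - 1) + z (i - 1)"
        using 3 zd[of i] by (simp add: pyramid_map_def)
      also have "z (i - 1) = (-1) ^ (i - 1) * (s (i - 1) - 1)" using 3 by (simp add: z_def)
      also have "(-1) ^ (i - 1) = - ((-1::real) ^ i)" using 3 by (cases i) auto
      finally show ?thesis using rec[OF 3(1)] sign[of i "y i"] by (simp add: algebra_simps)
    qed
  qed
  show thesis by (rule that[OF z pz])
qed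

section \<open>Generating all lattice points of the Euler hyperplane\<close>

lemma euler_hyperplane_1: "x \<in> euler_hyperplane 1 \<longleftrightarrow> x = (\<lambda>i. if i = 0 then 2 else 0)"
  by (auto simp: euler_hyperplane_def real_space_def fun_eq_iff)

text \<open>The difference of the f-vectors of \<open>S\<close> and \<open>Q\<close> changes the
  weight by one, so a multiple of it moves any lattice point into the image of
  \<open>pyramid_map\<close>, where the induction hypothesis applies. In dimension 1 the Euler
  hyperplane is a single point.\<close>

lemma euler_lattice_subset_hull:
  assumes "1 \<le> d" "d \<le> DIM('a::euclidean_space)"
  shows "euler_hyperplane d \<inter> int_lattice d \<subseteq> int_affine_hull (f_vectors TYPE('a) d)"
  using assms
proof (induction d rule: nat_induct_at_least)
  case base
  show ?case
  proof
    fix x assume x: "x \<in> euler_hyperplane 1 \<inter> int_lattice 1"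
    obtain P :: "'a set" where P: "polytope P" "aff_dim P = int 1"
      using exists_polytope[where 'a='a, OF base] by blast
    have "f_vector 1 P \<in> euler_hyperplane 1" using f_vector_euler[OF P] by (rule IntD1)
    then have "x = f_vector 1 P" using IntD1[OF x] unfolding euler_hyperplane_1 by metis
    then have "x \<in> f_vectors TYPE('a) 1"
      using f_vector_in_f_vectors[OF P] by simp
    then show "x \<in> int_affine_hull (f_vectors TYPE('a) 1)" by (rule int_affine_hull_inc)
  qed
next
  case (Suc d)
  \<comment> \<open>Since \<open>d\<close> is at least 1, \<open>C\<close> is nonempty. Making
    \<open>B\<close> a pyramid over it fixes \<open>weighted_sum B = -1\<close>, so truncating the
    pyramid over \<open>B\<close> gives -2.\<close>
  have "d - 1 \<le> DIM('a)" using Suc.prems by simp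
  then obtain C :: "'a set" where C: "polytope C" "aff_dim C = int (d - 1)"
    using exists_polytope[where 'a='a and d="d - 1"] by blast
  have "aff_dim C < int DIM('a)" using C(2) Suc.prems by linarith
  then obtain v where v: "v \<notin> affine hull C" by (rule exists_apex)
  have "C \<noteq> {}" using C(2) by auto
  define B where "B = convex hull (insert v C)"
  have B: "polytope B" unfolding B_def by (rule pyramid_polytope[OF C(1)])
  have dimB: "aff_dim B = int d" "weighted_sum B = -1"
    using weighted_sum_pyramid[OF C(1) \<open>C \<noteq> {}\<close> v]
      aff_dim_pyramid[OF v] C(2) \<open>1 \<le> d\<close> unfolding B_def by linarith+
  have "B \<noteq> {}" using dimB by auto
  have "aff_dim B < int DIM('a)" using dimB Suc.prems by linarith
  then obtain w where w: "w \<notin> affine hull B" by (rule exists_apex)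
  define S where "S = convex hull (insert w B)"
  have S: "polytope S" unfolding S_def by (rule pyramid_polytope[OF B])
  have dimS: "aff_dim S = int (Suc d)" "weighted_sum S = -1"
    using weighted_sum_pyramid[OF B \<open>B \<noteq> {}\<close> w]
      aff_dim_pyramid[OF w] dimB unfolding S_def by linarith+
  from truncated_pyramid[OF B \<open>B \<noteq> {}\<close> w]
  obtain Q :: "'a set" where Q': "polytope Q" "aff_dim Q = aff_dim B + 1" "weighted_sum Q = weighted_sum B - 1" .
  have Q: "polytope Q" by (rule Q'(1))
  have dimQ: "aff_dim Q = int (Suc d)" "weighted_sum Q = -2"
    using Q'(2,3) dimB by linarith+
  let ?s = "f_vector (Suc d) S" and ?q = "f_vector (Suc d) Q"
  have sq: "?s \<in> f_vectors TYPE('a) (Suc d)" "?q \<in> f_vectors TYPE('a) (Suc d)"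
    using f_vector_in_f_vectors[OF S dimS(1)] f_vector_in_f_vectors[OF Q dimQ(1)] .
  show ?case
  proof
    fix x assume x: "x \<in> euler_hyperplane (Suc d) \<inter> int_lattice (Suc d)"
    have "x i \<in> \<int>" for i
      using x by (cases "i < Suc d") (auto simp: int_lattice_def real_space_def)
    then have "euler_weight d x - (real d + 1 - (-1) ^ d) \<in> \<int>"
      unfolding euler_weight_def by (intro Ints_diff Ints_sum Ints_mult Ints_add Ints_power) auto
    then obtain c where c: "euler_weight d x - (real d + 1 - (-1) ^ d) = of_int c"
      by (rule Ints_cases)
    \<comment> \<open>The weight of \<open>?s\<close> minus that of \<open>?q\<close> is -1, so
      adding the difference \<open>c\<close> times lowers the weight of \<open>x\<close> by its
      excess \<open>c\<close>.\<close>
    define y where "y = (\<lambda>i. x i + of_int c * (?s i - ?q i))"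
    have "euler_weight d y = euler_weight d x + of_int c * (euler_weight d ?s - euler_weight d ?q)"
      unfolding euler_weight_def y_def sum_distrib_left sum_subtractf[symmetric] sum.distrib[symmetric]
      by (intro sum.cong refl) (simp add: algebra_simps)
    then have wy: "euler_weight d y = real d + 1 - (-1) ^ d"
      using c by (simp add: euler_weight_f_vector[OF S dimS(1)] euler_weight_f_vector[OF Q dimQ(1)] dimS(2) dimQ(2))
    \<comment> \<open>The lattice points of the Euler hyperplane are closed under integral affine
      combinations, so \<open>y\<close> is again one of them.\<close>
    have "y \<in> int_affine_hull (euler_hyperplane (Suc d) \<inter> int_lattice (Suc d))"
      unfolding y_def
      by (rule int_affine_hull_add_diff[OF int_affine_hull_inc[OF x] f_vector_euler[OF S dimS(1)] f_vector_euler[OF Q dimQ(1)]])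
    then have "y \<in> euler_hyperplane (Suc d) \<inter> int_lattice (Suc d)"
      by (rule subsetD[OF int_affine_hull_subset_euler[OF order_refl]])
    then obtain z where z: "z \<in> euler_hyperplane d \<inter> int_lattice d" "pyramid_map d z = y"
      using pyramid_map_surj[OF _ wy] by metis
    then have "y \<in> int_affine_hull (f_vectors TYPE('a) (Suc d))"
      using pyramid_map_hull[OF Suc.prems] Suc.IH Suc.prems by auto
    \<comment> \<open>Exchanging the roles of \<open>?s\<close> and \<open>?q\<close> undoes the
      shift from \<open>x\<close> to \<open>y\<close>.\<close>
    from int_affine_hull_add_diff[OF this sq(2,1), of c]
    show "x \<in> int_affine_hull (f_vectors TYPE('a) (Suc d))"
      by (simp add: y_def algebra_simps)
  qed
qed

theorem theorem3p2:
  fixes d :: nat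
  assumes "d \<ge> 2" and "d \<le> DIM('a::euclidean_space)"
  shows "int_affine_hull (f_vectors TYPE('a) d) = euler_hyperplane d \<inter> int_lattice d"
proof
  show "int_affine_hull (f_vectors TYPE('a) d) \<subseteq> euler_hyperplane d \<inter> int_lattice d"
    by (intro int_affine_hull_subset_euler) (auto simp: f_vectors_def dest: f_vector_euler)
  show "euler_hyperplane d \<inter> int_lattice d \<subseteq> int_affine_hull (f_vectors TYPE('a) d)"
    using assms by (intro euler_lattice_subset_hull) auto
qed

end
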